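(* Let $J\ge1$, $n\ge1$, $\epsilon>0$, let $C\in\mathbb{R}^{n\times n}$, and let $\mathbf{C}\in\mathbb{R}^{n^{J+1}}$ be the tensor with elements $$\mathbf{C}_{i_0,\dots,i_J}=\sum_{j=1}^JC_{i_0,i_j}.$$ Let $\mathbf{K}=\exp(-\mathbf{C}/\epsilon)$, $K=\exp(-C/\epsilon)$ (elementwise exponentials), and $\mathbf{U}=u_0\otimes u_1\otimes\cdots\otimes u_J$ with $u_0,\dots,u_J\in\mathbb{R}^n$. Then $$P_0(\mathbf{K}\odot\mathbf{U})=u_0\odot\bigodot_{\ell=1}^J(Ku_\ell),$$ $$P_j(\mathbf{K}\odot\mathbf{U})=u_j\odot K^T\Big(u_0\odot\bigodot_{\ell=1,\,\ell\ne j}^J(Ku_\ell)\Big)\quad\text{for }j=1,\dots,J.$$ For $j,j_1,j_2\in\{1,\dots,J\}$ with $j_1\ne j_2$, the pair-wise projections are given by $$P_{0,j}(\mathbf{K}\odot\mathbf{U})=\mathrm{diag}\Big(u_0\odot\bigodot_{\ell=1,\,\ell\ne j}^J(Ku_\ell)\Big)K\,\mathrm{diag}(u_j),$$ $$P_{j_1,j_2}(\mathbf{K}\odot\mathbf{U})=\mathrm{diag}(u_{j_1})K^T\,\mathrm{diag}\Big(u_0\odot\bigodot_{\ell=1,\,\ell\ne j_1,j_2}^J(Ku_\ell)\Big)K\,\mathrm{diag}(u_{j_2}).$$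
   Context: Tensors in $\mathbb{R}^{n^{J+1}}$ are real arrays indexed by $(i_0,\dots,i_J)\in\{1,\dots,n\}^{J+1}$; $\odot$ and $\bigodot$ denote elementwise multiplication (an empty elementwise product of vectors is the all-ones vector); $(u_0\otimes\cdots\otimes u_J)_{i_0,\dots,i_J}=\prod_{j=0}^J(u_j)_{i_j}$; $\mathrm{diag}(u)$ is the diagonal matrix with the entries of $u$ on its diagonal. The projection on the $j$-th marginal is the vector $P_j(\mathbf{M})\in\mathbb{R}^n$ with $P_j(\mathbf{M})_k=\sum\mathbf{M}_{i_0,\dots,i_J}$, the sum being over all indices with $i_j=k$ fixed; the bi-marginal projection is the matrix $P_{j_1,j_2}(\mathbf{M})\in\mathbb{R}^{n\times n}$ with $P_{j_1,j_2}(\mathbf{M})_{k,\ell}=\sum\mathbf{M}_{i_0,\dots,i_J}$, the sum being over all indices with $i_{j_1}=k$ and $i_{j_2}=\ell$ fixed. *)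

theory Defs
  imports "HOL-Analysis.Analysis"
begin

text \<open>
  Vectors and matrices use the types \<open>real ^ 'n\<close> and \<open>real ^ 'n ^ 'n\<close>, so \<open>n = CARD('n)\<close>.
  On \<open>real ^ 'n\<close> the operations \<open>*\<close> and \<open>\<Prod>\<close> are elementwise, and an empty product is
  the all-ones vector.

  An array of order \<open>J + 1\<close> is a function on multi-indices \<open>i\<close>, where \<open>i j\<close> is the
  \<open>j\<close>-th index. Only its values on \<open>multi_indices J\<close> are meaningful. Extensionality
  makes that set a bijective copy of the \<open>(J + 1)\<close>-fold power of the index type; in particular
  it is finite, so the sums below are proper.
\<close>

type_synonym 'n tensor = "(nat \<Rightarrow> 'n) \<Rightarrow> real"

definition multi_indices :: "nat \<Rightarrow> (nat \<Rightarrow> 'n) set" where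
  "multi_indices J = ({0..J} \<rightarrow>\<^sub>E UNIV)"

definition tensor_times :: "'n tensor \<Rightarrow> 'n tensor \<Rightarrow> 'n tensor" (infixl "\<odot>" 70) where
  "M \<odot> N = (\<lambda>i. M i * N i)"

definition outer_product :: "nat \<Rightarrow> (nat \<Rightarrow> real ^ 'n) \<Rightarrow> ('n::finite) tensor" where
  "outer_product J u = (\<lambda>i. \<Prod>j=0..J. u j $ i j)"

definition marginal :: "nat \<Rightarrow> nat \<Rightarrow> ('n::finite) tensor \<Rightarrow> real ^ 'n" where
  "marginal J j M = (\<chi> k. \<Sum>i\<in>{i \<in> multi_indices J. i j = k}. M i)"

definition bimarginal :: "nat \<Rightarrow> nat \<Rightarrow> nat \<Rightarrow> ('n::finite) tensor \<Rightarrow> real ^ 'n ^ 'n" where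
  "bimarginal J j\<^sub>1 j\<^sub>2 M =
     (\<chi> k l. \<Sum>i\<in>{i \<in> multi_indices J. i j\<^sub>1 = k \<and> i j\<^sub>2 = l}. M i)"

definition diag :: "real ^ 'n \<Rightarrow> real ^ 'n ^ ('n::finite)" where
  "diag u = (\<chi> k l. if k = l then u $ k else 0)"

end

theory Submission
  imports Defs
begin

text \<open>
  For fixed \<open>i 0 = k\<close>, the entries of \<open>KK \<odot> U\<close> are a product of factors each depending on a single
  remaining index, so the sum over the multi-indices in a box factorises. All four projections
  are sums over boxes in which some sides are the whole index set and the others are singletons.
\<close>

lemma prod_vec_component:
  fixes f :: "'a \<Rightarrow> 'b::comm_semiring_1 ^ 'n"
  shows "(\<Prod>a\<in>A. f a) $ k = (\<Prod>a\<in>A. f a $ k)"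
  by (induction A rule: infinite_finite_induct) auto

lemma diag_mult_component: "(diag v ** A) $ k $ l = v $ k * A $ k $ l"
  by (simp add: matrix_matrix_mult_def diag_def if_distrib if_distribR cong: if_cong)

lemma mult_diag_component: "(A ** diag v) $ k $ l = A $ k $ l * v $ l"
  by (simp add: matrix_matrix_mult_def diag_def if_distrib if_distribR cong: if_cong)

text \<open>Once \<open>i 0 = k\<close> is fixed, each factor \<open>f j k (i j)\<close> depends on
  its own index alone, so distributivity turns the sum over the remaining sides into a product of
  sums. The sides \<open>B j\<close> stay arbitrary so that one lemma serves all
  projections.\<close>

lemma sum_PiE_factor:
  fixes a :: "'a \<Rightarrow> 'b::comm_semiring_1" and f :: "nat \<Rightarrow> 'a \<Rightarrow> 'a \<Rightarrow> 'b"
  assumes fin: "\<And>j. j \<le> J \<Longrightarrow> finite (B j)"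
  shows "(\<Sum>i\<in>PiE {0..J} B. a (i 0) * (\<Prod>j=1..J. f j (i 0) (i j)))
    = (\<Sum>k\<in>B 0. a k * (\<Prod>j=1..J. \<Sum>m\<in>B j. f j k m))"
proof -
  let ?h = "\<lambda>i. a (i 0) * (\<Prod>j=1..J. f j (i 0) (i j))"
  have "(\<Sum>i\<in>PiE {0..J} B. ?h i) = (\<Sum>k\<in>B 0. \<Sum>i\<in>{i \<in> PiE {0..J} B. i 0 = k}. ?h i)"
    by (rule sum.group[symmetric]) (use fin in \<open>auto intro!: finite_PiE\<close>)
  also have "\<dots> = (\<Sum>k\<in>B 0. a k * (\<Prod>j=1..J. \<Sum>m\<in>B j. f j k m))"
  proof (rule sum.cong[OF refl])
    fix k assume k: "k \<in> B 0"
    \<comment> \<open>Absorbing \<open>a\<close> as the factor at index 0 makes the summand a single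
      product over \<open>{0..J}\<close>; the side \<open>{k}\<close> then contributes exactly
      \<open>a k\<close>.\<close>
    let ?g = "\<lambda>j m. if j = 0 then a m else f j k m"
    have range: "{0..J} = insert 0 {1..J}" by auto
    have "(\<Sum>i\<in>{i \<in> PiE {0..J} B. i 0 = k}. ?h i)
        = (\<Sum>i\<in>PiE {0..J} (B(0 := {k})). \<Prod>j=0..J. ?g j (i j))"
    proof (rule sum.cong)
      show "{i \<in> PiE {0..J} B. i 0 = k} = PiE {0..J} (B(0 := {k}))"
        using k by (auto simp: PiE_iff extensional_def split: if_splits)
    qed (auto simp: range PiE_iff intro!: prod.cong)
    also have "\<dots> = (\<Prod>j=0..J. \<Sum>m\<in>(B(0 := {k})) j. ?g j m)"
      by (rule prod_sum_PiE[symmetric]) (use fin in auto)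
    also have "\<dots> = a k * (\<Prod>j=1..J. \<Sum>m\<in>B j. f j k m)"
      by (auto simp: range intro!: prod.cong)
    finally show "(\<Sum>i\<in>{i \<in> PiE {0..J} B. i 0 = k}. ?h i)
        = a k * (\<Prod>j=1..J. \<Sum>m\<in>B j. f j k m)" .
  qed
  finally show ?thesis .
qed

lemma marginal_eq_sum_box:
  assumes "j \<le> J"
  shows "marginal J j M $ k = (\<Sum>i\<in>PiE {0..J} ((\<lambda>_. UNIV)(j := {k})). M i)"
  unfolding marginal_def multi_indices_def
  using assms by (auto simp: PiE_iff extensional_def intro!: sum.cong split: if_splits)

text \<open>Distinctness keeps the second function update from overwriting the first, so both
  constraints survive as singleton sides.\<close>

lemma bimarginal_eq_sum_box:
  assumes "j\<^sub>1 \<le> J" "j\<^sub>2 \<le> J" "j\<^sub>1 \<noteq> j\<^sub>2"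
  shows "bimarginal J j\<^sub>1 j\<^sub>2 M $ k $ l
    = (\<Sum>i\<in>PiE {0..J} ((\<lambda>_. UNIV)(j\<^sub>1 := {k}, j\<^sub>2 := {l})). M i)"
  unfolding bimarginal_def multi_indices_def
  using assms by (auto simp: PiE_iff extensional_def intro!: sum.cong split: if_splits)

theorem proposition2:
  fixes J :: nat and \<epsilon> :: real
    and C K :: "real ^ 'n ^ 'n"
    and CC KK U :: "('n::finite) tensor"
    and u :: "nat \<Rightarrow> real ^ 'n"
  assumes "J \<ge> 1" and "\<epsilon> > 0"
    and "CC = (\<lambda>i. \<Sum>j=1..J. C $ i 0 $ i j)"
    and "KK = (\<lambda>i. exp (- CC i / \<epsilon>))"
    and "K = map_matrix (\<lambda>c. exp (- c / \<epsilon>)) C"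
    and "U = outer_product J u"
  shows "marginal J 0 (KK \<odot> U) = u 0 * (\<Prod>l\<in>{1..J}. K *v u l)
    \<and> (\<forall>j\<in>{1..J}. marginal J j (KK \<odot> U)
          = u j * (transpose K *v (u 0 * (\<Prod>l\<in>{1..J} - {j}. K *v u l))))
    \<and> (\<forall>j\<in>{1..J}. bimarginal J 0 j (KK \<odot> U)
          = diag (u 0 * (\<Prod>l\<in>{1..J} - {j}. K *v u l)) ** K ** diag (u j))
    \<and> (\<forall>j\<^sub>1\<in>{1..J}. \<forall>j\<^sub>2\<in>{1..J}. j\<^sub>1 \<noteq> j\<^sub>2 \<longrightarrow> bimarginal J j\<^sub>1 j\<^sub>2 (KK \<odot> U)
          = diag (u j\<^sub>1) ** transpose K
            ** diag (u 0 * (\<Prod>l\<in>{1..J} - {j\<^sub>1, j\<^sub>2}. K *v u l)) ** K ** diag (u j\<^sub>2))"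
proof -
  define E :: "'n tensor" where "E = KK \<odot> U"
  have E: "E i = u 0 $ i 0 * (\<Prod>j=1..J. K $ i 0 $ i j * u j $ i j)" for i
  proof -
    \<comment> \<open>Every term of the cost couples index 0 with one other index, so the
      exponential of the sum is a product of entries of \<open>K\<close>.\<close>
    have "KK i = (\<Prod>j=1..J. K $ i 0 $ i j)"
      unfolding assms by (simp add: map_matrix_def sum_divide_distrib exp_sum flip: sum_negf)
    moreover have "{0..J} = insert 0 {1..J}" by auto
    ultimately show ?thesis
      unfolding E_def tensor_times_def \<open>U = _\<close> outer_product_def by (simp add: prod.distrib)
  qed
  \<comment> \<open>For \<open>l\<close> in \<open>{1..J}\<close>, a full side yields the component
    \<open>(K *v u l) $ m\<close>, and a side \<open>{k}\<close> the single term
    \<open>K $ m $ k * u l $ k\<close>.\<close>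
  have box: "(\<Sum>i\<in>PiE {0..J} B. E i)
      = (\<Sum>m\<in>B 0. u 0 $ m * (\<Prod>l=1..J. \<Sum>p\<in>B l. K $ m $ p * u l $ p))" for B :: "nat \<Rightarrow> 'n set"
    unfolding E by (rule sum_PiE_factor) simp
  \<comment> \<open>\<open>A\<close> will be the set of nonzero indices with singleton sides;
    \<open>?w A $ m\<close> collects what all other indices contribute when index 0 equals
    \<open>m\<close>.\<close>
  let ?w = "\<lambda>A. u 0 * (\<Prod>l\<in>{1..J} - A. K *v u l)"
  have w: "?w A $ m = u 0 $ m * (\<Prod>l\<in>{1..J} - A. \<Sum>p\<in>UNIV. K $ m $ p * u l $ p)" for A m
    by (simp add: prod_vec_component matrix_vector_mult_def)
  have "marginal J 0 E = u 0 * (\<Prod>l\<in>{1..J}. K *v u l)"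
    by (simp add: vec_eq_iff marginal_eq_sum_box box prod_vec_component matrix_vector_mult_def)
  moreover have "marginal J j E = u j * (transpose K *v ?w {j})" if j: "j \<in> {1..J}" for j
  proof -
    have "marginal J j E $ k = (u j * (transpose K *v ?w {j})) $ k" for k
    proof -
      \<comment> \<open>Side 0 is full because \<open>j\<close> is at least 1, so a sum over the row
        index \<open>m\<close> of \<open>K\<close> remains: this is where \<open>transpose K\<close>
        comes from.\<close>
      let ?B = "(\<lambda>_. UNIV)(j := {k})"
      have "(\<Prod>l=1..J. \<Sum>p\<in>?B l. K $ m $ p * u l $ p)
          = K $ m $ k * u j $ k * (\<Prod>l\<in>{1..J} - {j}. \<Sum>p\<in>UNIV. K $ m $ p * u l $ p)" for m
        by (subst prod.remove[OF _ j]) (auto intro!: prod.cong)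
      then have "marginal J j E $ k = (\<Sum>m\<in>UNIV. K $ m $ k * u j $ k * ?w {j} $ m)"
        unfolding w using j by (simp add: marginal_eq_sum_box box mult_ac)
      also have "\<dots> = (u j * (transpose K *v ?w {j})) $ k"
        by (simp add: matrix_vector_mult_def transpose_def sum_distrib_left mult_ac)
      finally show ?thesis .
    qed
    then show ?thesis by (simp only: vec_eq_iff) simp
  qed
  moreover have "bimarginal J 0 j E = diag (?w {j}) ** K ** diag (u j)" if j: "j \<in> {1..J}" for j
  proof -
    have "bimarginal J 0 j E $ k $ l = (diag (?w {j}) ** K ** diag (u j)) $ k $ l" for k l
    proof -
      \<comment> \<open>Side 0 is now \<open>{k}\<close>, so the outer sum collapses to
        \<open>m = k\<close> and each entry is \<open>K $ k $ l\<close> scaled by a row factor and a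
        column factor.\<close>
      let ?B = "(\<lambda>_. UNIV)(0 := {k}, j := {l})"
      have "(\<Prod>q=1..J. \<Sum>p\<in>?B q. K $ k $ p * u q $ p)
          = K $ k $ l * u j $ l * (\<Prod>q\<in>{1..J} - {j}. \<Sum>p\<in>UNIV. K $ k $ p * u q $ p)"
        by (subst prod.remove[OF _ j]) (auto intro!: prod.cong)
      then have "bimarginal J 0 j E $ k $ l = K $ k $ l * u j $ l * ?w {j} $ k"
        unfolding w using j by (simp add: bimarginal_eq_sum_box box mult_ac)
      then show ?thesis
        by (simp only: mult_diag_component diag_mult_component mult_ac)
    qed
    then show ?thesis by (simp only: vec_eq_iff) simp
  qed
  moreover have "bimarginal J j\<^sub>1 j\<^sub>2 E
      = diag (u j\<^sub>1) ** transpose K ** diag (?w {j\<^sub>1, j\<^sub>2}) ** K ** diag (u j\<^sub>2)"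
    if j: "j\<^sub>1 \<in> {1..J}" "j\<^sub>2 \<in> {1..J}" "j\<^sub>1 \<noteq> j\<^sub>2" for j\<^sub>1 j\<^sub>2
  proof -
    have "bimarginal J j\<^sub>1 j\<^sub>2 E $ k $ l
        = (diag (u j\<^sub>1) ** transpose K ** diag (?w {j\<^sub>1, j\<^sub>2}) ** K ** diag (u j\<^sub>2)) $ k $ l" for k l
    proof -
      let ?B = "(\<lambda>_. UNIV)(j\<^sub>1 := {k}, j\<^sub>2 := {l})"
      let ?s = "\<lambda>m q. \<Sum>p\<in>?B q. K $ m $ p * u q $ p"
      \<comment> \<open>The membership condition of each instance of \<open>prod.remove\<close>
        fails once its index is gone, so the rewriting terminates.\<close>
      have "(\<Prod>q=1..J. ?s m q) = ?s m j\<^sub>1 * (?s m j\<^sub>2 * (\<Prod>q\<in>{1..J} - {j\<^sub>1} - {j\<^sub>2}. ?s m q))" for m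
        using j by (simp only: prod.remove[where x = j\<^sub>1] prod.remove[where x = j\<^sub>2]
            finite_atLeastAtMost finite_Diff Diff_iff singleton_iff simp_thms)
      moreover have "(\<Prod>q\<in>{1..J} - {j\<^sub>1} - {j\<^sub>2}. ?s m q)
          = (\<Prod>q\<in>{1..J} - {j\<^sub>1, j\<^sub>2}. \<Sum>p\<in>UNIV. K $ m $ p * u q $ p)" for m
        by (auto intro!: prod.cong)
      ultimately have "(\<Prod>q=1..J. ?s m q) = K $ m $ k * u j\<^sub>1 $ k * (K $ m $ l * u j\<^sub>2 $ l
          * (\<Prod>q\<in>{1..J} - {j\<^sub>1, j\<^sub>2}. \<Sum>p\<in>UNIV. K $ m $ p * u q $ p))" for m
        using j by simp
      then have "bimarginal J j\<^sub>1 j\<^sub>2 E $ k $ l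
          = (\<Sum>m\<in>UNIV. u j\<^sub>1 $ k * K $ m $ k * ?w {j\<^sub>1, j\<^sub>2} $ m * K $ m $ l * u j\<^sub>2 $ l)"
        unfolding w using j by (simp add: bimarginal_eq_sum_box box mult_ac)
      \<comment> \<open>The sum over index 0 is read as the matrix product with the right-hand
        \<open>K\<close>; the last diagonal factor is constant in \<open>m\<close> and comes
        out.\<close>
      also have "\<dots> = (\<Sum>m\<in>UNIV. (diag (u j\<^sub>1) ** transpose K ** diag (?w {j\<^sub>1, j\<^sub>2})) $ k $ m
          * K $ m $ l) * u j\<^sub>2 $ l"
        by (simp add: mult_diag_component diag_mult_component transpose_def sum_distrib_right)
      also have "\<dots> = (diag (u j\<^sub>1) ** transpose K ** diag (?w {j\<^sub>1, j\<^sub>2}) ** K ** diag (u j\<^sub>2)) $ k $ l"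
        by (subst mult_diag_component, subst (4) matrix_matrix_mult_def) simp
      finally show ?thesis .
    qed
    then show ?thesis by (simp only: vec_eq_iff) simp
  qed
  ultimately show ?thesis unfolding E_def by blast
qed

end
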